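(* Let $\mathscr H$ be a complex Hilbert space, let $\mathfrak M$ be a nonempty set of bounded self-adjoint operators on $\mathscr H$ that is bounded from below, and let $\mathfrak L$ be the set of all its lower bounds. Let $u\in\mathscr H$ be a unit vector and set $$\alpha:=\inf\{(Au,u):A\in\mathfrak M\},\quad \mathfrak M_u:=\{A\in\mathfrak M:(Au,u)=\alpha\},\quad \mathfrak L_u:=\{L\in\mathfrak L:(Lu,u)=\alpha\}.$$ Suppose that $\mathfrak M_u$ is nonempty. If $\mathfrak L_u$ is not empty, then $$Au=Bu\quad\text{for all }A,B\in\mathfrak M_u.$$
   Context: $\mathfrak S$ denotes the real vector space of bounded self-adjoint operators on $\mathscr H$, with Löwner's order: $S\le T$ iff $(Sv,v)\le (Tv,v)$ for all $v\in\mathscr H$. An operator $L\in\mathfrak S$ is a lower bound of $\mathfrak M$ if $L\le A$ for all $A\in\mathfrak M$; $\mathfrak M$ is bounded from below if it has a lower bound. *)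

theory Defs
  imports "HOL-Analysis.Analysis"
begin

class complex_vector = real_vector +
  fixes scaleC :: "complex \<Rightarrow> 'a \<Rightarrow> 'a"  (infixr "*\<^sub>C" 75)
  assumes scaleC_add_right: "a *\<^sub>C (x + y) = a *\<^sub>C x + a *\<^sub>C y"
    and scaleC_add_left: "(a + b) *\<^sub>C x = a *\<^sub>C x + b *\<^sub>C x"
    and scaleC_scaleC: "a *\<^sub>C b *\<^sub>C x = (a * b) *\<^sub>C x"
    and scaleC_one: "1 *\<^sub>C x = x"
    and scaleR_scaleC: "r *\<^sub>R x = complex_of_real r *\<^sub>C x"

(* The inner product is linear in the first argument. The norm, and with it the metric and
   the topology inherited from real_normed_vector, is the one induced by the inner product. *)
class complex_inner = complex_vector + real_normed_vector +
  fixes cinner :: "'a \<Rightarrow> 'a \<Rightarrow> complex"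
  assumes cinner_commute: "cinner x y = cnj (cinner y x)"
    and cinner_add_left: "cinner (x + y) z = cinner x z + cinner y z"
    and cinner_scaleC_left: "cinner (a *\<^sub>C x) y = a * cinner x y"
    and cinner_ge_zero: "0 \<le> Re (cinner x x)"
    and cinner_eq_zero_iff: "cinner x x = 0 \<longleftrightarrow> x = 0"
    and norm_eq_sqrt_cinner: "norm x = sqrt (Re (cinner x x))"

class complex_hilbert = complex_inner + complete_space

instantiation complex :: complex_hilbert
begin

definition scaleC_complex :: "complex \<Rightarrow> complex \<Rightarrow> complex"
  where "scaleC_complex a x = a * x"

definition cinner_complex :: "complex \<Rightarrow> complex \<Rightarrow> complex"
  where "cinner_complex x y = x * cnj y"

instance
  by standard
    (auto simp: scaleC_complex_def cinner_complex_def algebra_simps scaleR_conv_of_real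
      cmod_def power2_eq_square)

end

definition bounded_clinear :: "('a::complex_inner \<Rightarrow> 'a) \<Rightarrow> bool"
  where "bounded_clinear T \<longleftrightarrow> bounded_linear T \<and> (\<forall>c x. T (c *\<^sub>C x) = c *\<^sub>C T x)"

definition selfadjoint_ops :: "('a::complex_inner \<Rightarrow> 'a) set"
  where "selfadjoint_ops =
    {T. bounded_clinear T \<and> (\<forall>x y. cinner (T x) y = cinner x (T y))}"

(* Only used for self-adjoint operators, where cinner (S v) v is real; taking Re merely
   converts its type. *)
definition lowner_le :: "('a::complex_inner \<Rightarrow> 'a) \<Rightarrow> ('a \<Rightarrow> 'a) \<Rightarrow> bool"
  where "lowner_le S T \<longleftrightarrow> (\<forall>v. Re (cinner (S v) v) \<le> Re (cinner (T v) v))"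

definition lower_bounds :: "('a::complex_inner \<Rightarrow> 'a) set \<Rightarrow> ('a \<Rightarrow> 'a) set"
  where "lower_bounds M = {L \<in> selfadjoint_ops. \<forall>A\<in>M. lowner_le L A}"

definition bounded_from_below :: "('a::complex_inner \<Rightarrow> 'a) set \<Rightarrow> bool"
  where "bounded_from_below M \<longleftrightarrow> (\<exists>L. L \<in> lower_bounds M)"

end

theory Submission
  imports Defs
begin

text \<open>
  A lower bound \<open>L\<close> in \<open>\<L>\<^sub>u\<close> touches every \<open>A\<close> in \<open>M\<^sub>u\<close> from below at \<open>u\<close>: the operator
  \<open>A - L\<close> is positive, and its quadratic form vanishes at \<open>u\<close>. A zero of a positive quadratic form
  is a minimum of it, so its first variation there vanishes too, and for a self-adjoint operator
  this says that the vector \<open>u\<close> lies in the kernel (lemma \<open>positive_form_zero_imp_kernel\<close>). Hence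
  \<open>A u = L u\<close>. The right-hand side does not depend on \<open>A\<close>, so all operators in \<open>M\<^sub>u\<close> agree at \<open>u\<close>.
\<close>

lemma cinner_add_right: "cinner x (y + z) = cinner x y + cinner x (z::'a::complex_inner)"
  by (metis cinner_add_left cinner_commute complex_cnj_add)

lemma cinner_scaleR_left: "cinner (r *\<^sub>R x) y = r * cinner x (y::'a::complex_inner)"
  by (simp add: scaleR_scaleC cinner_scaleC_left)

lemma cinner_scaleR_right: "cinner x (r *\<^sub>R y) = r * cinner x (y::'a::complex_inner)"
  by (metis cinner_commute cinner_scaleR_left complex_cnj_mult complex_cnj_complex_of_real)

lemma cinner_diff_left: "cinner (x - y) z = cinner x z - cinner y (z::'a::complex_inner)"
  by (metis cinner_add_left add_diff_cancel_right' diff_add_cancel)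

lemma cinner_diff_right: "cinner x (y - z) = cinner x y - cinner x (z::'a::complex_inner)"
  by (metis cinner_add_right add_diff_cancel_right' diff_add_cancel)

lemma scaleC_diff_right: "a *\<^sub>C (x - y) = a *\<^sub>C x - a *\<^sub>C (y::'a::complex_vector)"
  by (metis scaleC_add_right add_diff_cancel_right' diff_add_cancel)

lemma selfadjoint_ops_diff:
  assumes "S \<in> selfadjoint_ops" and "T \<in> selfadjoint_ops"
  shows "(\<lambda>x. S x - T x) \<in> selfadjoint_ops"
  using assms
  by (auto simp: selfadjoint_ops_def bounded_clinear_def bounded_linear_sub
      scaleC_diff_right cinner_diff_left cinner_diff_right)

text \<open>
  A real quadratic polynomial without constant term changes sign at \<open>0\<close> unless its linear
  coefficient vanishes.
\<close>
lemma linear_coeff_zero_if_quadratic_nonneg: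
  fixes b c :: real
  assumes "\<And>t. 0 \<le> 2 * t * b + t\<^sup>2 * c"
  shows "b = 0"
proof -
  \<comment> \<open>The denominator exceeds \<open>c\<close>, so at \<open>t = - b / k\<close> the linear term outweighs the square.\<close>
  define k where "k = \<bar>c\<bar> + 1"
  have "k > 0" and "c < k"
    by (auto simp: k_def)
  have "2 * (- b / k) * b + (- b / k)\<^sup>2 * c = - (b\<^sup>2 * (2 * k - c) / k\<^sup>2)"
    using \<open>k > 0\<close> by (simp add: field_simps power2_eq_square)
  with assms[of "- b / k"] have "b\<^sup>2 * (2 * k - c) / k\<^sup>2 \<le> 0"
    by simp
  then have "b\<^sup>2 * (2 * k - c) \<le> 0"
    using \<open>k > 0\<close> by (simp add: divide_le_0_iff)
  moreover have "2 * k - c > 0"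
    using \<open>k > 0\<close> \<open>c < k\<close> by simp
  ultimately show "b = 0"
    by (simp add: mult_le_0_iff)
qed

text \<open>
  Moving from the minimum \<open>u\<close> in the direction \<open>T u\<close>, the form changes to first order by twice the
  square of the norm of \<open>T u\<close>.
\<close>
lemma positive_form_zero_imp_kernel:
  fixes T :: "'a::complex_inner \<Rightarrow> 'a"
  assumes T: "T \<in> selfadjoint_ops"
    and pos: "\<And>v. 0 \<le> Re (cinner (T v) v)"
    and zero: "Re (cinner (T u) u) = 0"
  shows "T u = 0"
proof -
  define v where "v = T u"
  have lin: "linear T" and sa: "cinner (T x) y = cinner x (T y)" for x y
    using T by (auto simp: selfadjoint_ops_def bounded_clinear_def bounded_linear.linear)
  have "0 \<le> 2 * t * Re (cinner v v) + t\<^sup>2 * Re (cinner (T v) v)" for t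
  proof -
    have "Re (cinner (T (u + t *\<^sub>R v)) (u + t *\<^sub>R v))
        = Re (cinner (T u) u) + t * Re (cinner (T u) v) + t * Re (cinner (T v) u)
          + t\<^sup>2 * Re (cinner (T v) v)"
      by (simp add: linear_add[OF lin] linear_scale[OF lin] cinner_add_left cinner_add_right
          cinner_scaleR_left cinner_scaleR_right power2_eq_square algebra_simps)
    moreover have "cinner (T u) v = cinner v v" and "cinner (T v) u = cinner v v"
      by (simp_all add: v_def sa)
    ultimately show ?thesis
      using pos[of "u + t *\<^sub>R v"] zero by simp
  qed
  then have "Re (cinner v v) = 0"
    by (rule linear_coeff_zero_if_quadratic_nonneg)
  then have "norm v = 0"
    by (simp add: norm_eq_sqrt_cinner)
  then show ?thesis
    by (simp add: v_def)
qed

lemma lowner_le_contact_imp_eq: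
  fixes L A :: "'a::complex_inner \<Rightarrow> 'a"
  assumes L: "L \<in> selfadjoint_ops" and A: "A \<in> selfadjoint_ops"
    and le: "lowner_le L A"
    and contact: "cinner (L u) u = cinner (A u) u"
  shows "A u = L u"
proof -
  have "A u - L u = 0"
  proof (rule positive_form_zero_imp_kernel[OF selfadjoint_ops_diff[OF A L]])
    show "0 \<le> Re (cinner (A v - L v) v)" for v
      using le by (simp add: lowner_le_def cinner_diff_left)
    show "Re (cinner (A u - L u) u) = 0"
      using contact by (simp add: cinner_diff_left)
  qed
  then show ?thesis
    by simp
qed

theorem theorem4p8:
  fixes M \<L> M\<^sub>u \<L>\<^sub>u :: "('a::complex_hilbert \<Rightarrow> 'a) set"
    and u :: 'a and \<alpha> :: real
  assumes "M \<subseteq> selfadjoint_ops"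
    and "M \<noteq> {}"
    and "bounded_from_below M"
    and "\<L> = lower_bounds M"
    and "norm u = 1"
    and "\<alpha> = (INF A\<in>M. Re (cinner (A u) u))"
    and "M\<^sub>u = {A \<in> M. cinner (A u) u = complex_of_real \<alpha>}"
    and "\<L>\<^sub>u = {L \<in> \<L>. cinner (L u) u = complex_of_real \<alpha>}"
    and "M\<^sub>u \<noteq> {}"
    and "\<L>\<^sub>u \<noteq> {}"
  shows "\<forall>A\<in>M\<^sub>u. \<forall>B\<in>M\<^sub>u. A u = B u"
proof -
  from \<open>\<L>\<^sub>u \<noteq> {}\<close> obtain L where "L \<in> \<L>\<^sub>u"
    by blast
  then have L: "L \<in> lower_bounds M" and Lu: "cinner (L u) u = complex_of_real \<alpha>"
    using assms(4,8) by auto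
  have "A u = L u" if "A \<in> M\<^sub>u" for A
  proof (rule lowner_le_contact_imp_eq[of L A u])
    show "L \<in> selfadjoint_ops" and "A \<in> selfadjoint_ops" and "lowner_le L A"
      using L that assms(1,7) by (auto simp: lower_bounds_def)
    show "cinner (L u) u = cinner (A u) u"
      using Lu that assms(7) by simp
  qed
  then show ?thesis
    by metis
qed

end
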